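(* Let $(X,\mathcal{T})$ be a regular, noncompact Hausdorff topological space, and fix a $\kappa$-saturated nonstandard extension of $(X,\mathcal{T})$, where $\kappa$ is greater than the cardinality of $\mathcal{T}$. Let $(Z,\mathcal{T}_Z)$ be a Hausdorff compactification of $(X,\mathcal{T})$. Define an equivalence relation $\sim$ on the set of remote points of ${}^{\ast}X$ by: $p\sim q$ if and only if there is a point $z\in Z\setminus X$ such that both $p$ and $q$ are in the monad of $z$. Let $(Y,\mathcal{T}_Y)$ be the space constructed from ${}^{\ast}X$ and $\sim$ as described in the context. Let $F:Z\to Y$ be the map that is the identity from $X$ as a subset of $Z$ to $X$ as a subset of $Y$, and that maps each $z\in Z\setminus X$ to the r-point of $Y$ given by the equivalence class consisting of those points of ${}^{\ast}X$ that are in the monad of $z$. Then $F$ is a bijection, and indeed a homeomorphism from $(Z,\mathcal{T}_Z)$ onto $(Y,\mathcal{T}_Y)$. Consequently, every Hausdorff compactification of $X$ can be obtained from an equivalence relation on the remote points of ${}^{\ast}X$; that is, for every Hausdorff compactification $(Z,\mathcal{T}_Z)$ of $(X,\mathcal{T})$ there is an equivalence relation on the remote points of ${}^{\ast}X$ whose associated space $(Y,\mathcal{T}_Y)$ is homeomorphic to $(Z,\mathcal{T}_Z)$ by a homeomorphism that is the identity on $X$.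
   Context: Compactification: a compactification of $(X,\mathcal{T})$ is a compact space $(Z,\mathcal{T}_Z)$ such that $X$ is a dense subset of $Z$ and the identity mapping of $X$ into $Z$ is a homeomorphism from $(X,\mathcal{T})$ onto $X$ with the relative $\mathcal{T}_Z$-topology. It is a Hausdorff compactification if $(Z,\mathcal{T}_Z)$ is Hausdorff. Monads: for $x\in X$, the monad of $x$ is $\bigcap\{{}^{\ast}U : U\in\mathcal{T},\ x\in U\}$. For $z\in Z$, a point $p\in{}^{\ast}X$ is in the monad of $z$ if $p\in{}^{\ast}(V\cap X)$ for every $V\in\mathcal{T}_Z$ with $z\in V$ (equivalently, if the nonstandard extension also contains $Z$, $p\in{}^{\ast}V$ for every such $V$). Remote points: a point $p\in{}^{\ast}X$ is near-standard if it is in the monad of some $x\in X$ (this $x$ is unique since $X$ is Hausdorff and is called the standard part of $p$). A point $p\in{}^{\ast}X$ is remote if it is not near-standard. Construction of $(Y,\mathcal{T}_Y)$ from an equivalence relation $\sim$ on the set of remote points of ${}^{\ast}X$: The point set $Y$ consists of the points of $X$ (called s-points) together with all $\sim$-equivalence classes of remote points, each class being treated as a single point (called an r-point). Let $\varphi:{}^{\ast}X\to Y$ send each near-standard point to its standard part and each remote point to the r-point given by its equivalence class. For an r-point $y$, the neighborhood filter base $\mathcal{B}(y)$ consists of all sets $\varphi({}^{\ast}U)$, where $U\in\mathcal{T}$ and ${}^{\ast}U$ contains the entire equivalence class corresponding to $y$. For an s-point $x$, the neighborhood filter base $\mathcal{B}(x)$ consists of all sets $\varphi({}^{\ast}U)$,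 where $U\in\mathcal{T}$ and $x\in U$. A set $O\subseteq Y$ is open, i.e. belongs to $\mathcal{T}_Y$, if and only if for each $p\in O$ there is an element $\varphi({}^{\ast}U)\in\mathcal{B}(p)$ with $\varphi({}^{\ast}U)\subseteq O$. (Members of $\mathcal{B}(p)$ are not assumed to be open or to have any particular interior.) *)

theory Defs
  imports "HOL-Analysis.Analysis" "HOL-Library.Extended_Nat"
begin

unbundle cardinal_syntax

section \<open>Superstructures and nonstandard extensions\<close>

text \<open>
  A superstructure over a set of individuals. Its objects are the individuals (tagged with
  \<open>Inl\<close>) and the sets (tagged with \<open>Inr\<close>); the latter are named by elements of
  the type \<open>'s\<close>, and \<open>elems\<close> gives the elements of a set object.
\<close>

record ('a, 's) superstr =
  individuals :: "'a set"
  set_objs :: "'s set"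
  elems :: "'s \<Rightarrow> ('a + 's) set"

definition universe :: "('a, 's) superstr \<Rightarrow> ('a + 's) set" where
  "universe V = Inl ` individuals V \<union> Inr ` set_objs V"

definition member :: "('a, 's) superstr \<Rightarrow> 'a + 's \<Rightarrow> 'a + 's \<Rightarrow> bool" where
  "member V a b = (case b of Inl x \<Rightarrow> False | Inr s \<Rightarrow> a \<in> elems V s)"

text \<open>The levels of the cumulative hierarchy: $V_0 = X$ and $V_{n+1} = V_n \cup P(V_n)$.\<close>

primrec level :: "('a, 's) superstr \<Rightarrow> nat \<Rightarrow> ('a + 's) set" where
  "level V 0 = Inl ` individuals V"
| "level V (Suc n) = level V n \<union> Inr ` {s \<in> set_objs V. elems V s \<subseteq> level V n}"

text \<open>
  The sets of a superstructure of height \<open>h\<close> are exactly the subsets of the levels below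
  \<open>h\<close>. For \<open>h = \<infinity>\<close> this is the usual superstructure, the union of all $V_n$; for finite
  \<open>h\<close> it is $V_h$. The finite heights are admitted because HOL does not prove that, for an
  infinite set of individuals, some type is large enough to hold all the finite levels at once.
\<close>

definition superstructure :: "enat \<Rightarrow> ('a, 's) superstr \<Rightarrow> bool" where
  "superstructure h V \<longleftrightarrow>
     bij_betw (elems V) (set_objs V) (\<Union>n\<in>{n. enat n < h}. Pow (level V n))"

definition obj_of :: "('a, 's) superstr \<Rightarrow> ('a + 's) set \<Rightarrow> 'a + 's" where
  "obj_of V A = Inr (the_inv_into (set_objs V) (elems V) A)"

text \<open>
  Bounded formulas of the language of set theory, with variables named by natural numbers;
  \<open>AllIn i j f\<close> is $\forall v_i \in v_j.\ f$. Constants for elements of the universe are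
  rendered by the values that the assignment gives to the free variables.
\<close>

datatype bformula =
    Elem nat nat
  | Equal nat nat
  | Neg bformula
  | Conj bformula bformula
  | AllIn nat nat bformula

primrec satisfies ::
    "('a, 's) superstr \<Rightarrow> bformula \<Rightarrow> (nat \<Rightarrow> 'a + 's) \<Rightarrow> bool" where
  "satisfies V (Elem i j) e \<longleftrightarrow> member V (e i) (e j)"
| "satisfies V (Equal i j) e \<longleftrightarrow> e i = e j"
| "satisfies V (Neg f) e \<longleftrightarrow> \<not> satisfies V f e"
| "satisfies V (Conj f g) e \<longleftrightarrow> satisfies V f e \<and> satisfies V g e"
| "satisfies V (AllIn i j f) e \<longleftrightarrow> (\<forall>a. member V a (e j) \<longrightarrow> satisfies V f (e(i := a)))"

text \<open>
  A nonstandard extension is a map \<open>star\<close> from the superstructure over a set of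
  individuals into the superstructure over the extension of that set, subject to the transfer
  principle. A standard individual \<open>x\<close> is not literally equal to its image; it
  is identified with \<open>star (Inl x)\<close>. Height at least 2 ensures that a topology on a set of
  individuals is an object of the superstructure.
\<close>

definition nonstandard_extension ::
    "enat \<Rightarrow> ('a, 's) superstr \<Rightarrow> ('b, 't) superstr \<Rightarrow> ('a + 's \<Rightarrow> 'b + 't) \<Rightarrow> bool" where
  "nonstandard_extension h V W star \<longleftrightarrow>
     2 \<le> h \<and> superstructure h V \<and> superstructure h W \<and>
     star ` universe V \<subseteq> universe W \<and>
     star (obj_of V (Inl ` individuals V)) = obj_of W (Inl ` individuals W) \<and>
     (\<forall>f e. (\<forall>i. e i \<in> universe V) \<longrightarrow>
        satisfies V f e = satisfies W f (\<lambda>i. star (e i)))"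

definition internal ::
    "('a, 's) superstr \<Rightarrow> ('b, 't) superstr \<Rightarrow> ('a + 's \<Rightarrow> 'b + 't) \<Rightarrow> 'b + 't \<Rightarrow> bool" where
  "internal V W star b \<longleftrightarrow> (\<exists>A\<in>set_objs V. member W b (star (Inr A)))"

definition saturated ::
    "'k rel \<Rightarrow> ('a, 's) superstr \<Rightarrow> ('b, 't) superstr \<Rightarrow> ('a + 's \<Rightarrow> 'b + 't) \<Rightarrow> bool" where
  "saturated \<kappa> V W star \<longleftrightarrow>
     (\<forall>\<F> \<subseteq> set_objs W.
        (\<forall>b\<in>\<F>. internal V W star (Inr b)) \<longrightarrow> |\<F>| <o \<kappa> \<longrightarrow>
        (\<forall>\<G> \<subseteq> \<F>. finite \<G> \<longrightarrow> \<Inter>(elems W ` \<G>) \<noteq> {}) \<longrightarrow>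
        \<Inter>(elems W ` \<F>) \<noteq> {})"

text \<open>The extension of a set \<open>A\<close> of standard individuals, as a set of nonstandard individuals.\<close>

definition hyperset ::
    "('a, 's) superstr \<Rightarrow> ('b, 't) superstr \<Rightarrow> ('a + 's \<Rightarrow> 'b + 't) \<Rightarrow> 'a set \<Rightarrow> 'b set" where
  "hyperset V W star A = {p. member W (Inl p) (star (obj_of V (Inl ` A)))}"


section \<open>Compactifications, monads and remote points\<close>

definition compactification :: "'a topology \<Rightarrow> 'a topology \<Rightarrow> bool" where
  "compactification T Z \<longleftrightarrow>
     compact_space Z \<and> topspace T \<subseteq> topspace Z \<and> Z closure_of topspace T = topspace Z \<and>
     homeomorphic_map T (subtopology Z (topspace T)) id"

definition Hausdorff_compactification :: "'a topology \<Rightarrow> 'a topology \<Rightarrow> bool" where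
  "Hausdorff_compactification T Z \<longleftrightarrow> compactification T Z \<and> Hausdorff_space Z"

text \<open>From here on, \<open>hx\<close> maps each set \<open>A\<close> of standard points to its extension
  (see \<open>hyperset\<close>).\<close>

definition monad :: "('a set \<Rightarrow> 'b set) \<Rightarrow> 'a topology \<Rightarrow> 'a \<Rightarrow> 'b set" where
  "monad hx T x = \<Inter>{hx U |U. openin T U \<and> x \<in> U}"

definition comp_monad ::
    "('a set \<Rightarrow> 'b set) \<Rightarrow> 'a topology \<Rightarrow> 'a topology \<Rightarrow> 'a \<Rightarrow> 'b set" where
  "comp_monad hx T Z z =
     {p \<in> hx (topspace T). \<forall>V. openin Z V \<and> z \<in> V \<longrightarrow> p \<in> hx (V \<inter> topspace T)}"

definition near_standard :: "('a set \<Rightarrow> 'b set) \<Rightarrow> 'a topology \<Rightarrow> 'b \<Rightarrow> bool" where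
  "near_standard hx T p \<longleftrightarrow> (\<exists>x\<in>topspace T. p \<in> monad hx T x)"

definition standard_part :: "('a set \<Rightarrow> 'b set) \<Rightarrow> 'a topology \<Rightarrow> 'b \<Rightarrow> 'a" where
  "standard_part hx T p = (THE x. x \<in> topspace T \<and> p \<in> monad hx T x)"

definition remote_points :: "('a set \<Rightarrow> 'b set) \<Rightarrow> 'a topology \<Rightarrow> 'b set" where
  "remote_points hx T = {p \<in> hx (topspace T). \<not> near_standard hx T p}"


section \<open>The space constructed from an equivalence relation on the remote points\<close>

text \<open>The s-points are tagged with \<open>Inl\<close>, the r-points with \<open>Inr\<close>.\<close>

definition Y_points ::
    "('a set \<Rightarrow> 'b set) \<Rightarrow> 'a topology \<Rightarrow> 'b rel \<Rightarrow> ('a + 'b set) set" where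
  "Y_points hx T r = Inl ` topspace T \<union> Inr ` (remote_points hx T // r)"

definition Y_map ::
    "('a set \<Rightarrow> 'b set) \<Rightarrow> 'a topology \<Rightarrow> 'b rel \<Rightarrow> 'b \<Rightarrow> 'a + 'b set" where
  "Y_map hx T r p =
     (if near_standard hx T p then Inl (standard_part hx T p) else Inr (r `` {p}))"

definition Y_base ::
    "('a set \<Rightarrow> 'b set) \<Rightarrow> 'a topology \<Rightarrow> 'b rel \<Rightarrow> 'a + 'b set \<Rightarrow> ('a + 'b set) set set" where
  "Y_base hx T r y =
     (case y of
        Inl x \<Rightarrow> {Y_map hx T r ` hx U |U. openin T U \<and> x \<in> U}
      | Inr c \<Rightarrow> {Y_map hx T r ` hx U |U. openin T U \<and> c \<subseteq> hx U})"

definition Y_open ::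
    "('a set \<Rightarrow> 'b set) \<Rightarrow> 'a topology \<Rightarrow> 'b rel \<Rightarrow> ('a + 'b set) set \<Rightarrow> bool" where
  "Y_open hx T r Q \<longleftrightarrow> Q \<subseteq> Y_points hx T r \<and> (\<forall>y\<in>Q. \<exists>N\<in>Y_base hx T r y. N \<subseteq> Q)"

definition Y_space ::
    "('a set \<Rightarrow> 'b set) \<Rightarrow> 'a topology \<Rightarrow> 'b rel \<Rightarrow> ('a + 'b set) topology" where
  "Y_space hx T r = topology (Y_open hx T r)"


section \<open>The relation and the map determined by a compactification\<close>

definition comp_rel ::
    "('a set \<Rightarrow> 'b set) \<Rightarrow> 'a topology \<Rightarrow> 'a topology \<Rightarrow> 'b rel" where
  "comp_rel hx T Z =
     {(p, q). p \<in> remote_points hx T \<and> q \<in> remote_points hx T \<and>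
        (\<exists>z\<in>topspace Z - topspace T. p \<in> comp_monad hx T Z z \<and> q \<in> comp_monad hx T Z z)}"

definition comp_map ::
    "('a set \<Rightarrow> 'b set) \<Rightarrow> 'a topology \<Rightarrow> 'a topology \<Rightarrow> 'a \<Rightarrow> 'a + 'b set" where
  "comp_map hx T Z z = (if z \<in> topspace T then Inl z else Inr (comp_monad hx T Z z))"


section \<open>The open sets form a topology\<close>

text \<open>
  \<open>Y_space\<close> is built with the total function \<open>topology\<close>, so it has the intended open sets
  only because of the following lemmas.
\<close>

lemma istopology_Y_open:
  assumes hx_Int: "\<And>A B. A \<subseteq> topspace T \<Longrightarrow> B \<subseteq> topspace T \<Longrightarrow> hx (A \<inter> B) = hx A \<inter> hx B"
  shows "istopology (Y_open hx T r)"
proof -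
  have base: "\<exists>N\<in>Y_base hx T r y. N \<subseteq> N1 \<inter> N2"
    if "N1 \<in> Y_base hx T r y" "N2 \<in> Y_base hx T r y" for y N1 N2
  proof (cases y)
    case (Inl x)
    have "N1 \<in> {Y_map hx T r ` hx U |U. openin T U \<and> x \<in> U}"
      using that(1) unfolding Y_base_def Inl sum.case .
    then obtain U1 where U1: "openin T U1" "x \<in> U1" "N1 = Y_map hx T r ` hx U1"
      by blast
    have "N2 \<in> {Y_map hx T r ` hx U |U. openin T U \<and> x \<in> U}"
      using that(2) unfolding Y_base_def Inl sum.case .
    then obtain U2 where U2: "openin T U2" "x \<in> U2" "N2 = Y_map hx T r ` hx U2"
      by blast
    note U = U1(1) U2(1) U1(2) U2(2) U1(3) U2(3)
    have "Y_map hx T r ` hx (U1 \<inter> U2) \<in> Y_base hx T r y"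
      using Inl U(1-4) by (auto simp: Y_base_def intro!: exI[of _ "U1 \<inter> U2"])
    moreover have "hx (U1 \<inter> U2) = hx U1 \<inter> hx U2"
      using U by (intro hx_Int openin_subset)
    ultimately show ?thesis using U(5,6) by (intro bexI[rotated]) auto
  next
    case (Inr c)
    have "N1 \<in> {Y_map hx T r ` hx U |U. openin T U \<and> c \<subseteq> hx U}"
      using that(1) unfolding Y_base_def Inr sum.case .
    then obtain U1 where U1: "openin T U1" "c \<subseteq> hx U1" "N1 = Y_map hx T r ` hx U1"
      by blast
    have "N2 \<in> {Y_map hx T r ` hx U |U. openin T U \<and> c \<subseteq> hx U}"
      using that(2) unfolding Y_base_def Inr sum.case .
    then obtain U2 where U2: "openin T U2" "c \<subseteq> hx U2" "N2 = Y_map hx T r ` hx U2"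
      by blast
    note U = U1(1) U2(1) U1(2) U2(2) U1(3) U2(3)
    have eq: "hx (U1 \<inter> U2) = hx U1 \<inter> hx U2"
      using U by (intro hx_Int openin_subset)
    then have "Y_map hx T r ` hx (U1 \<inter> U2) \<in> Y_base hx T r y"
      using Inr U(1-4) by (auto simp: Y_base_def intro!: exI[of _ "U1 \<inter> U2"])
    then show ?thesis using U(5,6) eq by (intro bexI[rotated]) auto
  qed
  show ?thesis
    unfolding istopology_def
  proof (intro conjI allI impI)
    fix P Q assume P: "Y_open hx T r P" and Q: "Y_open hx T r Q"
    show "Y_open hx T r (P \<inter> Q)"
      unfolding Y_open_def
    proof (intro conjI ballI)
      show "P \<inter> Q \<subseteq> Y_points hx T r" using P by (auto simp: Y_open_def)
      fix y assume "y \<in> P \<inter> Q"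
      then obtain N1 N2 where "N1 \<in> Y_base hx T r y" "N2 \<in> Y_base hx T r y" "N1 \<subseteq> P" "N2 \<subseteq> Q"
        using P Q unfolding Y_open_def by (meson IntD1 IntD2)
      then show "\<exists>N\<in>Y_base hx T r y. N \<subseteq> P \<inter> Q"
        using base[of N1 y N2] by (meson Int_mono subset_trans)
    qed
  next
    fix \<K> assume K: "\<forall>K\<in>\<K>. Y_open hx T r K"
    show "Y_open hx T r (\<Union>\<K>)"
      unfolding Y_open_def
    proof (intro conjI ballI)
      show "\<Union>\<K> \<subseteq> Y_points hx T r" using K by (auto simp: Y_open_def)
      fix y assume "y \<in> \<Union>\<K>"
      then obtain P where P: "P \<in> \<K>" "y \<in> P" by blast
      then obtain N where "N \<in> Y_base hx T r y" "N \<subseteq> P"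
        using K unfolding Y_open_def by meson
      then show "\<exists>N\<in>Y_base hx T r y. N \<subseteq> \<Union>\<K>"
        using P by blast
    qed
  qed
qed

lemma satisfies_transfer:
  assumes "nonstandard_extension h V W star" "\<And>i. e i \<in> universe V"
  shows "satisfies V f e = satisfies W f (\<lambda>i. star (e i))"
  using assms unfolding nonstandard_extension_def by blast

lemma obj_of_individuals:
  assumes "nonstandard_extension h V W star" "A \<subseteq> individuals V"
  shows "obj_of V (Inl ` A) \<in> universe V"
    and "member V a (obj_of V (Inl ` A)) \<longleftrightarrow> a \<in> Inl ` A"
proof -
  have bij: "bij_betw (elems V) (set_objs V) (\<Union>n\<in>{n. enat n < h}. Pow (level V n))"
    and h: "2 \<le> h"
    using assms(1) by (auto simp: nonstandard_extension_def superstructure_def)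
  have "enat 0 < h" using h by (cases h) (auto simp: numeral_eq_enat)
  moreover have "Inl ` A \<in> Pow (level V 0)" using assms(2) by auto
  ultimately have "Inl ` A \<in> (\<Union>n\<in>{n. enat n < h}. Pow (level V n))"
    by blast
  then have A: "Inl ` A \<in> elems V ` set_objs V"
    using bij by (simp add: bij_betw_def)
  have inj: "inj_on (elems V) (set_objs V)"
    using bij by (simp add: bij_betw_def)
  show "obj_of V (Inl ` A) \<in> universe V"
    using the_inv_into_into[OF inj A order_refl] by (simp add: obj_of_def universe_def)
  show "member V a (obj_of V (Inl ` A)) \<longleftrightarrow> a \<in> Inl ` A"
    using f_the_inv_into_f[OF inj A] by (simp add: obj_of_def member_def)
qed

lemma hyperset_Int:
  assumes ext: "nonstandard_extension h V W star"
    and A: "A \<subseteq> individuals V" and B: "B \<subseteq> individuals V"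
  shows "hyperset V W star (A \<inter> B) = hyperset V W star A \<inter> hyperset V W star B"
proof -
  define e where "e = (\<lambda>i::nat. if i = 0 then obj_of V (Inl ` A)
    else if i = 1 then obj_of V (Inl ` B) else obj_of V (Inl ` (A \<inter> B)))"
  have AB: "A \<inter> B \<subseteq> individuals V" using A by auto
  have e: "e i \<in> universe V" for i
    by (simp add: e_def obj_of_individuals(1)[OF ext] A B AB)
  note mem = obj_of_individuals(2)[OF ext A] obj_of_individuals(2)[OF ext B]
    obj_of_individuals(2)[OF ext AB]
  have "satisfies V (AllIn 3 2 (Conj (Elem 3 0) (Elem 3 1))) e"
    by (simp add: e_def mem) blast
  then have 1: "satisfies W (AllIn 3 2 (Conj (Elem 3 0) (Elem 3 1))) (\<lambda>i. star (e i))"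
    using satisfies_transfer[of h V W star e, OF ext e] by blast
  have "satisfies V (AllIn 3 0 (Neg (Conj (Elem 3 1) (Neg (Elem 3 2))))) e"
    by (simp add: e_def mem) blast
  then have 2: "satisfies W (AllIn 3 0 (Neg (Conj (Elem 3 1) (Neg (Elem 3 2))))) (\<lambda>i. star (e i))"
    using satisfies_transfer[of h V W star e, OF ext e] by blast
  show ?thesis
    using 1 2 by (auto simp: e_def hyperset_def)
qed

lemma openin_Y_space:
  assumes "nonstandard_extension h V W star" "topspace T \<subseteq> individuals V"
  shows "openin (Y_space (hyperset V W star) T r) Q \<longleftrightarrow> Y_open (hyperset V W star) T r Q"
proof -
  have "istopology (Y_open (hyperset V W star) T r)"
    using assms by (intro istopology_Y_open hyperset_Int) auto
  then show ?thesis
    by (simp add: Y_space_def topology_inverse')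
qed

end

(*
  Saturation makes every point z of Z the centre of a nonempty monad, and even makes the monad of z
  meet *A whenever z lies in the closure of A; compactness and the Hausdorff property say that
  these monads partition *X. The map from *X to Y therefore factors through F, and the image of *U
  is F of the closure of U. Since the compact Hausdorff space Z is regular, and since density of X
  puts every open V inside the closure of its trace on X, the closures of the traces of
  neighbourhoods of z form a neighbourhood base at z, which F carries to the filter base at F z.
*)
theory Submission
  imports Defs
begin

section \<open>Extensions of sets of individuals\<close>

text \<open>Level 1 is needed to name the singleton of a set object, and level 0 is needed in the
  extended superstructure \<open>W\<close>; \<open>obj_of_individuals\<close> speaks only of sets of
  individuals of \<open>V\<close>.\<close>

lemma obj_of_level:
  assumes sup: "superstructure h V" and n: "enat n < h" and A: "A \<subseteq> level V n"
  shows "obj_of V A \<in> Inr ` set_objs V"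
    and "member V a (obj_of V A) \<longleftrightarrow> a \<in> A"
proof -
  have bij: "bij_betw (elems V) (set_objs V) (\<Union>n\<in>{n. enat n < h}. Pow (level V n))"
    using sup by (simp add: superstructure_def)
  then have A': "A \<in> elems V ` set_objs V" and inj: "inj_on (elems V) (set_objs V)"
    using n A by (auto simp: bij_betw_def)
  show "obj_of V A \<in> Inr ` set_objs V"
    using the_inv_into_into[OF inj A' order_refl] by (simp add: obj_of_def)
  show "member V a (obj_of V A) \<longleftrightarrow> a \<in> A"
    using f_the_inv_into_f[OF inj A'] by (simp add: obj_of_def member_def)
qed

text \<open>\<open>hyperset\<close> collects only members tagged \<open>Inl\<close>, so it must be
  excluded that \<open>star\<close> of a set of individuals also has set objects as members.
  Transferring the inclusion of \<open>A\<close> in the set of all individuals does this, because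
  \<open>star\<close> sends that set to the individuals of \<open>W\<close>.\<close>

lemma member_star_individuals:
  assumes ext: "nonstandard_extension h V W star" and A: "A \<subseteq> individuals V"
  shows "member W a (star (obj_of V (Inl ` A))) \<longleftrightarrow> a \<in> Inl ` hyperset V W star A"
proof -
  define e where "e = (\<lambda>i::nat. if i = 0 then obj_of V (Inl ` A)
    else obj_of V (Inl ` individuals V))"
  have e: "e i \<in> universe V" for i
    by (simp add: e_def obj_of_individuals(1)[OF ext] A)
  have "satisfies V (AllIn 2 0 (Elem 2 1)) e"
    using A by (auto simp: e_def obj_of_individuals(2)[OF ext])
  then have "satisfies W (AllIn 2 0 (Elem 2 1)) (\<lambda>i. star (e i))"
    using satisfies_transfer[of h V W star e, OF ext e] by blast
  moreover have "star (obj_of V (Inl ` individuals V)) = obj_of W (Inl ` individuals W)"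
    and W: "superstructure h W" and h: "2 \<le> h"
    using ext by (auto simp: nonstandard_extension_def)
  ultimately have "member W a (obj_of W (Inl ` individuals W))"
    if "member W a (star (obj_of V (Inl ` A)))"
    using that by (auto simp: e_def)
  moreover have "enat 0 < h" using h by (cases h) (auto simp: numeral_eq_enat)
  ultimately have "a \<in> Inl ` individuals W" if "member W a (star (obj_of V (Inl ` A)))"
    using that obj_of_level(2)[OF W, of 0 "Inl ` individuals W"] by simp
  then show ?thesis by (auto simp: hyperset_def)
qed

lemma hyperset_Diff:
  assumes ext: "nonstandard_extension h V W star"
    and A: "A \<subseteq> individuals V" and B: "B \<subseteq> individuals V"
  shows "hyperset V W star (A - B) = hyperset V W star A - hyperset V W star B"
proof -
  define e where "e = (\<lambda>i::nat. if i = 0 then obj_of V (Inl ` A)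
    else if i = 1 then obj_of V (Inl ` B) else obj_of V (Inl ` (A - B)))"
  have AB: "A - B \<subseteq> individuals V" using A by auto
  have e: "e i \<in> universe V" for i
    by (simp add: e_def obj_of_individuals(1)[OF ext] A B AB)
  note mem = obj_of_individuals(2)[OF ext A] obj_of_individuals(2)[OF ext B]
    obj_of_individuals(2)[OF ext AB]
  have "satisfies V (AllIn 3 2 (Conj (Elem 3 0) (Neg (Elem 3 1)))) e"
    by (simp add: e_def mem) blast
  then have 1: "satisfies W (AllIn 3 2 (Conj (Elem 3 0) (Neg (Elem 3 1)))) (\<lambda>i. star (e i))"
    using satisfies_transfer[of h V W star e, OF ext e] by blast
  \<comment> \<open>In the language without disjunction this says that every element of
    \<open>A\<close> lies in \<open>B\<close> or in \<open>A - B\<close>.\<close>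
  have "satisfies V (AllIn 3 0 (Neg (Conj (Neg (Elem 3 1)) (Neg (Elem 3 2))))) e"
    by (simp add: e_def mem) blast
  then have 2: "satisfies W (AllIn 3 0 (Neg (Conj (Neg (Elem 3 1)) (Neg (Elem 3 2)))))
      (\<lambda>i. star (e i))"
    using satisfies_transfer[of h V W star e, OF ext e] by blast
  show ?thesis
    using 1 2 by (auto simp: e_def hyperset_def)
qed

lemma hyperset_nonempty:
  assumes ext: "nonstandard_extension h V W star"
    and A: "A \<subseteq> individuals V" "A \<noteq> {}"
  shows "hyperset V W star A \<noteq> {}"
proof -
  define e where "e = (\<lambda>i::nat. obj_of V (Inl ` A))"
  have e: "e i \<in> universe V" for i
    by (simp add: e_def obj_of_individuals(1)[OF ext] A)
  \<comment> \<open>Existence of an element, written with the bounded universal quantifier only;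
    \<open>Equal 1 1\<close> serves as truth.\<close>
  have "satisfies V (Neg (AllIn 1 0 (Neg (Equal 1 1)))) e"
    using A(2) by (auto simp: e_def obj_of_individuals(2)[OF ext A(1)])
  then have "satisfies W (Neg (AllIn 1 0 (Neg (Equal 1 1)))) (\<lambda>i. star (e i))"
    using satisfies_transfer[of h V W star e, OF ext e] by blast
  then show ?thesis
    by (auto simp: e_def member_star_individuals[OF ext A(1)])
qed

lemma hyperset_Inter:
  assumes ext: "nonstandard_extension h V W star"
    and "finite \<A>" "\<A> \<noteq> {}" "\<A> \<subseteq> Pow (individuals V)"
  shows "hyperset V W star (\<Inter>\<A>) = \<Inter>(hyperset V W star ` \<A>)"
  using assms(2-4)
proof (induction \<A> rule: finite_ne_induct)
  case (insert A \<A>)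
  then have "\<Inter>\<A> \<subseteq> individuals V" by blast
  then show ?case
    using insert by (simp add: hyperset_Int[OF ext])
qed simp

text \<open>An internal object is a member of the extension of some standard set; the singleton of
  \<open>A\<close> serves as that set. It is a subset of level 1, so height at least 2 makes it an
  object of \<open>V\<close>.\<close>

lemma internal_star_individuals:
  assumes ext: "nonstandard_extension h V W star" and A: "A \<subseteq> individuals V"
  shows "internal V W star (star (obj_of V (Inl ` A)))"
proof -
  have V: "superstructure h V" and h: "2 \<le> h"
    using ext by (auto simp: nonstandard_extension_def)
  have h0: "enat 0 < h" and h1: "enat 1 < h"
    using h by (cases h; auto simp: numeral_eq_enat)+
  have A0: "Inl ` A \<subseteq> level V 0" using A by auto
  define P where "P = obj_of V {obj_of V (Inl ` A)}"
  obtain t where t: "obj_of V (Inl ` A) = Inr t" "t \<in> set_objs V"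
    using obj_of_level(1)[OF V h0 A0] by blast
  then have "elems V t \<subseteq> level V 0"
    using obj_of_level(2)[OF V h0 A0] A0 by (auto simp: member_def)
  then have "{obj_of V (Inl ` A)} \<subseteq> level V 1"
    using t by simp
  note P = obj_of_level[OF V h1 this, folded P_def]
  define e where "e = (\<lambda>i::nat. if i = 0 then obj_of V (Inl ` A) else P)"
  have e: "e i \<in> universe V" for i
    using P(1) obj_of_individuals(1)[OF ext A] by (auto simp: e_def universe_def)
  have "satisfies V (Elem 0 1) e"
    using P(2) by (simp add: e_def)
  then have "satisfies W (Elem 0 1) (\<lambda>i. star (e i))"
    using satisfies_transfer[of h V W star e, OF ext e] by blast
  then show ?thesis
    using P(1) by (auto simp: e_def internal_def)
qed

text \<open>Carries saturation, which concerns internal set objects of \<open>W\<close>, over to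
  families of standard sets of individuals. Their extensions inherit the finite intersection
  property because extension commutes with finite intersections and preserves nonemptiness.\<close>

lemma hyperset_saturated:
  assumes ext: "nonstandard_extension h V W star" and sat: "saturated \<kappa> V W star"
    and \<A>: "\<A> \<subseteq> Pow (individuals V)" "|\<A>| <o \<kappa>" "\<A> \<noteq> {}"
    and fip: "\<And>\<G>. finite \<G> \<Longrightarrow> \<G> \<subseteq> \<A> \<Longrightarrow> \<Inter>\<G> \<noteq> {}"
  shows "\<Inter>(hyperset V W star ` \<A>) \<noteq> {}"
proof -
  define s where "s A = projr (star (obj_of V (Inl ` A)))" for A
  have s: "star (obj_of V (Inl ` A)) = Inr (s A)" "s A \<in> set_objs W"
    "elems W (s A) = Inl ` hyperset V W star A" if "A \<in> \<A>" for A
  proof -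
    have A: "A \<subseteq> individuals V" "A \<noteq> {}"
      using \<A>(1) fip[of "{A}"] that by auto
    \<comment> \<open>Having a member shows that the image is a set object and not an individual, so
      \<open>projr\<close> in \<open>s\<close> is meaningful.\<close>
    from hyperset_nonempty[OF ext A] obtain a where "member W a (star (obj_of V (Inl ` A)))"
      by (auto simp: member_star_individuals[OF ext A(1)])
    then show *: "star (obj_of V (Inl ` A)) = Inr (s A)"
      by (auto simp: s_def member_def split: sum.splits)
    have "star (obj_of V (Inl ` A)) \<in> universe W"
      using ext obj_of_individuals(1)[OF ext A(1)] by (auto simp: nonstandard_extension_def)
    then show "s A \<in> set_objs W"
      unfolding * by (auto simp: universe_def)
    show "elems W (s A) = Inl ` hyperset V W star A"
      using member_star_individuals[OF ext A(1)] unfolding * by (auto simp: member_def)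
  qed
  have "\<Inter>(elems W ` (s ` \<A>)) \<noteq> {}"
  proof (rule sat[unfolded saturated_def, rule_format])
    show "s ` \<A> \<subseteq> set_objs W" using s by auto
    show "internal V W star (Inr b)" if "b \<in> s ` \<A>" for b
      using that s(1) \<A>(1) internal_star_individuals[OF ext] by (metis PowD imageE subsetD)
    show "|s ` \<A>| <o \<kappa>"
      using card_of_image \<A>(2) by (rule ordLeq_ordLess_trans)
    fix \<G> assume "\<G> \<subseteq> s ` \<A>" "finite \<G>"
    then obtain \<H> where \<H>: "\<H> \<subseteq> \<A>" "finite \<H>" "\<G> = s ` \<H>"
      by (meson finite_subset_image)
    show "\<Inter>(elems W ` \<G>) \<noteq> {}"
    \<comment> \<open>The empty family has the universal set as its intersection;
      \<open>hyperset_Inter\<close> covers only nonempty families.\<close>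
    proof (cases "\<H> = {}")
      case False
      have "hyperset V W star (\<Inter>\<H>) \<noteq> {}"
        using \<H> \<A>(1) False fip[of \<H>] by (intro hyperset_nonempty[OF ext]) auto
      then obtain p where "p \<in> \<Inter>(hyperset V W star ` \<H>)"
        using hyperset_Inter[OF ext \<H>(2) False] \<H>(1) \<A>(1) by auto
      then have "Inl p \<in> \<Inter>(elems W ` \<G>)"
        using s(3) \<H> by auto
      then show ?thesis by blast
    qed (simp add: \<H>)
  qed
  then obtain a where a: "a \<in> elems W (s A)" if "A \<in> \<A>" for A
    by auto
  \<comment> \<open>One member of the family is needed to know that the common element
    \<open>a\<close> is an individual.\<close>
  obtain A where "A \<in> \<A>"
    using \<A>(3) by blast
  then obtain p where "a = Inl p"
    using a s(3) by blast
  then have "p \<in> \<Inter>(hyperset V W star ` \<A>)"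
    using a s(3) by auto
  then show ?thesis by blast
qed

section \<open>Monads of the points of a Hausdorff compactification\<close>

text \<open>Isolates what the topological argument uses of the extension: the Boolean rules, and
  saturation for families no larger than the topology of \<open>T\<close>. Superstructures do not
  appear from here until the final theorem.\<close>

locale saturated_compactification =
  fixes hx :: "'a set \<Rightarrow> 'b set" and T Z :: "'a topology"
  assumes Hausdorff_comp: "Hausdorff_compactification T Z"
    and hx_Int: "\<And>A B. A \<subseteq> topspace T \<Longrightarrow> B \<subseteq> topspace T \<Longrightarrow> hx (A \<inter> B) = hx A \<inter> hx B"
    and hx_Diff: "\<And>A B. A \<subseteq> topspace T \<Longrightarrow> B \<subseteq> topspace T \<Longrightarrow> hx (A - B) = hx A - hx B"
    and hx_saturated: "\<And>\<A>. \<A> \<subseteq> Pow (topspace T) \<Longrightarrow> |\<A>| \<le>o |{U. openin T U}| \<Longrightarrow> \<A> \<noteq> {} \<Longrightarrow>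
      (\<And>\<G>. finite \<G> \<Longrightarrow> \<G> \<subseteq> \<A> \<Longrightarrow> \<Inter>\<G> \<noteq> {}) \<Longrightarrow> \<Inter>(hx ` \<A>) \<noteq> {}"
begin

abbreviation X where "X \<equiv> topspace T"
abbreviation \<mu> where "\<mu> \<equiv> comp_monad hx T Z"
abbreviation F where "F \<equiv> comp_map hx T Z"
abbreviation r where "r \<equiv> comp_rel hx T Z"
abbreviation \<phi> where "\<phi> \<equiv> Y_map hx T r"

lemma compact_Z: "compact_space Z"
  and Hausdorff_Z: "Hausdorff_space Z"
  and X_subset: "X \<subseteq> topspace Z"
  and dense: "Z closure_of X = topspace Z"
  using Hausdorff_comp by (auto simp: Hausdorff_compactification_def compactification_def)

lemma openin_T_iff: "openin T U \<longleftrightarrow> (\<exists>V. openin Z V \<and> U = V \<inter> X)"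
proof -
  have "homeomorphic_map T (subtopology Z X) id"
    using Hausdorff_comp by (auto simp: Hausdorff_compactification_def compactification_def)
  then have "openin T U \<longleftrightarrow> openin (subtopology Z X) U" if "U \<subseteq> X"
    using homeomorphic_map_openness_eq[of T "subtopology Z X" id U] that
      homeomorphic_map_openness[of T "subtopology Z X" id U] by simp
  then show ?thesis
    by (metis inf_le2 openin_subset openin_subtopology)
qed

lemma openin_trace: "openin Z V \<Longrightarrow> openin T (V \<inter> X)"
  using openin_T_iff by blast

section \<open>Extensions of Boolean combinations of subsets of \<open>X\<close>\<close>

lemma hx_empty [simp]: "hx {} = {}"
  using hx_Diff[of X X] by simp

lemma hx_mono: "A \<subseteq> B \<Longrightarrow> B \<subseteq> X \<Longrightarrow> hx A \<subseteq> hx B"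
  using hx_Int[of A B] by (auto simp: inf.absorb1)

lemma hx_Un:
  assumes "A \<subseteq> X" "B \<subseteq> X"
  shows "hx (A \<union> B) = hx A \<union> hx B"
proof
  have "hx ((A \<union> B) - A) \<subseteq> hx B"
    using assms by (intro hx_mono) auto
  then show "hx (A \<union> B) \<subseteq> hx A \<union> hx B"
    using hx_Diff[of "A \<union> B" A] assms by auto
  show "hx A \<union> hx B \<subseteq> hx (A \<union> B)"
    using hx_mono[of _ "A \<union> B"] assms by auto
qed

lemma hx_Union:
  assumes "finite \<V>"
  shows "hx ((\<Union>\<V>) \<inter> X) = (\<Union>V\<in>\<V>. hx (V \<inter> X))"
  using assms
proof (induction \<V> rule: finite_induct)
  case (insert V \<V>)
  have "(\<Union>(insert V \<V>)) \<inter> X = (V \<inter> X) \<union> (\<Union>\<V> \<inter> X)" by auto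
  then show ?case
    using hx_Un[of "V \<inter> X" "\<Union>\<V> \<inter> X"] insert.IH by simp
qed simp

section \<open>Monads and closures\<close>

lemma monad_subset: "openin Z V \<Longrightarrow> z \<in> V \<Longrightarrow> \<mu> z \<subseteq> hx (V \<inter> X)"
  by (auto simp: comp_monad_def)

text \<open>Since \<open>z\<close> is in the closure of \<open>A\<close>, the sets
  \<open>V \<inter> A\<close> for open \<open>V\<close> around \<open>z\<close> have the finite
  intersection property. A point that saturation puts into all their extensions lies in both
  \<open>\<mu> z\<close> and \<open>hx A\<close>.\<close>

lemma monad_meets:
  assumes z: "z \<in> topspace Z" and A: "A \<subseteq> X" and cl: "z \<in> Z closure_of A"
  shows "\<mu> z \<inter> hx A \<noteq> {}"
proof -
  define \<A> where "\<A> = (\<lambda>V. V \<inter> A) ` {V. openin Z V \<and> z \<in> V}"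
  \<comment> \<open>\<open>Z\<close> may have more open sets than \<open>T\<close>, but
    \<open>V \<inter> A\<close> depends only on the trace of \<open>V\<close> on \<open>X\<close>.
    Hence the family is no larger than the topology of \<open>T\<close>.\<close>
  have "\<A> \<subseteq> (\<lambda>U. U \<inter> A) ` {U. openin T U}"
  proof
    fix B assume "B \<in> \<A>"
    then obtain V where "openin Z V" "B = (V \<inter> X) \<inter> A"
      using A by (auto simp: \<A>_def)
    then show "B \<in> (\<lambda>U. U \<inter> A) ` {U. openin T U}"
      using openin_trace by auto
  qed
  then have "|\<A>| \<le>o |{U. openin T U}|"
    using card_of_image card_of_mono1 ordLeq_transitive by metis
  moreover have "topspace Z \<inter> A \<in> \<A>"
    using z by (auto simp: \<A>_def)
  moreover have "\<A> \<subseteq> Pow X"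
    using A by (auto simp: \<A>_def)
  moreover have "\<Inter>\<G> \<noteq> {}" if \<G>: "finite \<G>" "\<G> \<subseteq> \<A>" for \<G>
  proof (cases "\<G> = {}")
    case False
    obtain \<V> where \<V>: "finite \<V>" "\<V> \<subseteq> {V. openin Z V \<and> z \<in> V}" "\<G> = (\<lambda>V. V \<inter> A) ` \<V>"
      using \<G> unfolding \<A>_def by (meson finite_subset_image)
    then have "openin Z (\<Inter>\<V>)" "z \<in> \<Inter>\<V>"
      using False by (auto intro!: openin_Inter)
    then obtain a where "a \<in> A" "a \<in> \<Inter>\<V>"
      using cl unfolding in_closure_of by meson
    then show ?thesis
      using \<V>(3) by blast
  qed simp
  ultimately have "\<Inter>(hx ` \<A>) \<noteq> {}"
    by (intro hx_saturated) auto
  then obtain p where "p \<in> \<Inter>(hx ` \<A>)"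
    by blast
  then have p: "p \<in> hx (V \<inter> A)" if "openin Z V" "z \<in> V" for V
    using that by (simp add: \<A>_def)
  have "p \<in> hx (V \<inter> X)" if "openin Z V" "z \<in> V" for V
    using p[OF that] hx_mono[of "V \<inter> A" "V \<inter> X"] A by auto
  moreover have "p \<in> hx A"
    using p[OF openin_topspace z] A X_subset by (simp add: inf.absorb2)
  moreover have "p \<in> hx X"
    using \<open>p \<in> hx A\<close> hx_mono[OF A] by auto
  ultimately show ?thesis
    by (auto simp: comp_monad_def)
qed

lemma monad_meets_iff:
  assumes "z \<in> topspace Z" "A \<subseteq> X"
  shows "\<mu> z \<inter> hx A \<noteq> {} \<longleftrightarrow> z \<in> Z closure_of A"
proof
  \<comment> \<open>Conversely, a neighbourhood of \<open>z\<close> missing \<open>A\<close> would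
    have a trace whose extension contains \<open>\<mu> z\<close> and misses
    \<open>hx A\<close>.\<close>
  assume ne: "\<mu> z \<inter> hx A \<noteq> {}"
  have "V \<inter> A \<noteq> {}" if "openin Z V" "z \<in> V" for V
  proof
    assume "V \<inter> A = {}"
    then have "hx (V \<inter> X) \<inter> hx A = {}"
      using hx_Int[of "V \<inter> X" A] assms(2) by (metis hx_empty inf.absorb2 inf_assoc inf_le2)
    then show False
      using ne monad_subset[OF that] by auto
  qed
  then show "z \<in> Z closure_of A"
    using assms(1) by (fastforce simp: in_closure_of)
qed (use assms monad_meets in auto)

section \<open>The monads partition the extension of \<open>X\<close>\<close>

lemma monad_nonempty: "z \<in> topspace Z \<Longrightarrow> \<mu> z \<noteq> {}"
  using monad_meets[of z X] dense by auto

text \<open>Disjoint neighbourhoods in \<open>Z\<close> have disjoint traces, hence traces with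
  disjoint extensions.\<close>

lemma monad_disjoint:
  assumes "p \<in> \<mu> z" "p \<in> \<mu> w" "z \<in> topspace Z" "w \<in> topspace Z"
  shows "z = w"
proof (rule ccontr)
  assume "z \<noteq> w"
  then obtain V V' where V: "openin Z V" "openin Z V'" "z \<in> V" "w \<in> V'" "disjnt V V'"
    using Hausdorff_Z assms(3,4) unfolding Hausdorff_space_def by meson
  then have "p \<in> hx (V \<inter> X) \<inter> hx (V' \<inter> X)"
    using monad_subset assms(1,2) by blast
  then have "p \<in> hx ((V \<inter> X) \<inter> (V' \<inter> X))"
    using hx_Int[of "V \<inter> X" "V' \<inter> X"] by auto
  moreover have "(V \<inter> X) \<inter> (V' \<inter> X) = {}"
    using V(5) by (auto simp: disjnt_def)
  ultimately show False by simp
qed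

text \<open>If \<open>p\<close> were in no monad, the open sets whose traces have extensions
  avoiding \<open>p\<close> would cover \<open>Z\<close>. Extension commutes with the union of a
  finite subcover, so \<open>p\<close> would avoid \<open>hx X\<close>.\<close>

lemma monad_cover:
  assumes p: "p \<in> hx X"
  obtains z where "z \<in> topspace Z" "p \<in> \<mu> z"
proof -
  have False if none: "\<forall>z\<in>topspace Z. p \<notin> \<mu> z"
  proof -
    define \<U> where "\<U> = {V. openin Z V \<and> p \<notin> hx (V \<inter> X)}"
    have "topspace Z \<subseteq> \<Union>\<U>"
      using none p by (fastforce simp: \<U>_def comp_monad_def)
    then obtain \<V> where \<V>: "finite \<V>" "\<V> \<subseteq> \<U>" "topspace Z \<subseteq> \<Union>\<V>"
      using compact_Z unfolding compact_space_alt by (metis (no_types, lifting) \<U>_def mem_Collect_eq)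
    then have "\<Union>\<V> \<inter> X = X"
      using X_subset by auto
    then have "p \<in> (\<Union>V\<in>\<V>. hx (V \<inter> X))"
      using hx_Union[OF \<V>(1)] p by simp
    then show False
      using \<V>(2) by (auto simp: \<U>_def)
  qed
  then show thesis using that by blast
qed

text \<open>The open sets of \<open>T\<close> are exactly the traces of those of \<open>Z\<close>,
  so both notions of monad intersect the same extensions.\<close>

lemma monad_eq:
  assumes "x \<in> X"
  shows "monad hx T x = \<mu> x"
proof
  show "monad hx T x \<subseteq> \<mu> x"
  proof
    fix p assume p: "p \<in> monad hx T x"
    then have "p \<in> hx (V \<inter> X)" if "openin Z V" "x \<in> V" for V
      using that assms openin_trace by (auto simp: monad_def)
    moreover have "p \<in> hx X"
      using p assms by (auto simp: monad_def)
    ultimately show "p \<in> \<mu> x"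
      by (simp add: comp_monad_def)
  qed
  show "\<mu> x \<subseteq> monad hx T x"
    by (auto simp: monad_def comp_monad_def openin_T_iff)
qed

lemma near_standard_iff:
  assumes "z \<in> topspace Z" "p \<in> \<mu> z"
  shows "near_standard hx T p \<longleftrightarrow> z \<in> X"
proof
  assume "near_standard hx T p"
  then obtain x where "x \<in> X" "p \<in> \<mu> x"
    unfolding near_standard_def using monad_eq by blast
  then show "z \<in> X"
    using monad_disjoint[OF assms(2) _ assms(1)] X_subset by blast
next
  assume "z \<in> X"
  then show "near_standard hx T p"
    using assms(2) monad_eq unfolding near_standard_def by blast
qed

text \<open>Each point of \<open>hx X\<close> lies in the monad of exactly one point of
  \<open>Z\<close>, and it is near-standard exactly when that point belongs to
  \<open>X\<close>.\<close>

lemma remote_points_eq: "remote_points hx T = (\<Union>z\<in>topspace Z - X. \<mu> z)"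
proof
  show "remote_points hx T \<subseteq> (\<Union>z\<in>topspace Z - X. \<mu> z)"
  proof
    fix p assume p: "p \<in> remote_points hx T"
    then obtain z where z: "z \<in> topspace Z" "p \<in> \<mu> z"
      using monad_cover unfolding remote_points_def by blast
    then have "z \<notin> X"
      using near_standard_iff[OF z] p by (simp add: remote_points_def)
    then show "p \<in> (\<Union>z\<in>topspace Z - X. \<mu> z)"
      using z by blast
  qed
  show "(\<Union>z\<in>topspace Z - X. \<mu> z) \<subseteq> remote_points hx T"
    using near_standard_iff by (auto simp: remote_points_def comp_monad_def)
qed

section \<open>The homeomorphism onto the constructed space\<close>

lemma comp_rel_eq: "r = (\<Union>z\<in>topspace Z - X. \<mu> z \<times> \<mu> z)"
  unfolding comp_rel_def remote_points_eq by blast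

lemma comp_rel_class:
  assumes "z \<in> topspace Z - X" "p \<in> \<mu> z"
  shows "r `` {p} = \<mu> z"
proof -
  have "w = z" if "w \<in> topspace Z - X" "p \<in> \<mu> w" for w
    using assms that monad_disjoint[of p w z] by blast
  then show ?thesis
    using assms unfolding comp_rel_eq by blast
qed

lemma equiv_comp_rel: "equiv (remote_points hx T) r"
proof (rule equivI)
  show "r \<subseteq> remote_points hx T \<times> remote_points hx T"
    by (auto simp: comp_rel_def)
  show "refl_on (remote_points hx T) r"
    by (auto simp: refl_on_def comp_rel_eq remote_points_eq)
  show "sym r"
    by (auto simp: sym_def comp_rel_def)
  show "trans r"
  proof (rule transI)
    fix p q s assume "(p, q) \<in> r" "(q, s) \<in> r"
    then obtain z w where zw: "z \<in> topspace Z - X" "w \<in> topspace Z - X"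
      "p \<in> \<mu> z" "q \<in> \<mu> z" "q \<in> \<mu> w" "s \<in> \<mu> w"
      unfolding comp_rel_eq by blast
    then have "z = w"
      using monad_disjoint[of q z w] by blast
    then show "(p, s) \<in> r"
      using zw unfolding comp_rel_eq by blast
  qed
qed

text \<open>The monads outside \<open>X\<close> partition the remote points. Nonemptiness matters:
  an empty monad would not be a class.\<close>

lemma quotient_comp_rel: "remote_points hx T // r = \<mu> ` (topspace Z - X)"
proof
  show "remote_points hx T // r \<subseteq> \<mu> ` (topspace Z - X)"
    by (auto simp: quotient_def remote_points_eq comp_rel_class)
  show "\<mu> ` (topspace Z - X) \<subseteq> remote_points hx T // r"
  proof
    fix c assume "c \<in> \<mu> ` (topspace Z - X)"
    then obtain z where z: "z \<in> topspace Z - X" "c = \<mu> z" by blast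
    then obtain p where p: "p \<in> \<mu> z"
      using monad_nonempty by blast
    then have "p \<in> remote_points hx T"
      using z by (auto simp: remote_points_eq)
    then show "c \<in> remote_points hx T // r"
      using comp_rel_class[OF z(1) p] z(2) by (auto simp: quotient_def)
  qed
qed

section \<open>Bijectivity of \<open>F\<close> and the images of extensions\<close>

lemma comp_map_image: "F ` topspace Z = Y_points hx T r"
proof -
  have "F ` X = Inl ` X" "F ` (topspace Z - X) = Inr ` \<mu> ` (topspace Z - X)"
    by (auto simp: comp_map_def)
  moreover have "topspace Z = X \<union> (topspace Z - X)"
    using X_subset by auto
  ultimately show ?thesis
    by (metis Y_points_def image_Un quotient_comp_rel)
qed

lemma inj_on_comp_map: "inj_on F (topspace Z)"
proof (rule inj_onI)
  fix z w assume zw: "z \<in> topspace Z" "w \<in> topspace Z" "F z = F w"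
  then show "z = w"
    using monad_nonempty[of z] monad_disjoint[of _ z w]
    by (auto simp: comp_map_def split: if_splits)
qed

text \<open>This is the factorization of \<open>\<phi>\<close> through \<open>F\<close>:
  \<open>\<phi>\<close> is constant on each monad, both for standard parts and for remote
  classes.\<close>

lemma Y_map_monad:
  assumes z: "z \<in> topspace Z" "p \<in> \<mu> z"
  shows "\<phi> p = F z"
proof (cases "z \<in> X")
  case True
  have "standard_part hx T p = z"
    unfolding standard_part_def
    using z True monad_disjoint X_subset by (intro the_equality) (auto simp: monad_eq)
  then show ?thesis
    using True near_standard_iff[OF z] by (simp add: Y_map_def comp_map_def)
next
  case False
  then show ?thesis
    using z near_standard_iff[OF z] comp_rel_class by (simp add: Y_map_def comp_map_def)
qed

text \<open>\<open>\<phi>\<close> collapses \<open>\<mu> z\<close> to \<open>F z\<close>, and the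
  monads that meet \<open>hx U\<close> are those of the points in the closure of
  \<open>U\<close>.\<close>

lemma Y_map_image_hx:
  assumes U: "U \<subseteq> X"
  shows "\<phi> ` hx U = F ` (Z closure_of U)"
proof
  show "\<phi> ` hx U \<subseteq> F ` (Z closure_of U)"
  proof
    fix y assume "y \<in> \<phi> ` hx U"
    then obtain p where p: "p \<in> hx U" "y = \<phi> p" by blast
    then have "p \<in> hx X"
      using hx_mono[OF U] by auto
    then obtain z where z: "z \<in> topspace Z" "p \<in> \<mu> z"
      by (rule monad_cover)
    then have "z \<in> Z closure_of U"
      using monad_meets_iff[OF z(1) U] p(1) by blast
    then show "y \<in> F ` (Z closure_of U)"
      using p(2) Y_map_monad[OF z] by simp
  qed
  show "F ` (Z closure_of U) \<subseteq> \<phi> ` hx U"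
  proof
    fix y assume "y \<in> F ` (Z closure_of U)"
    then obtain z where z: "z \<in> Z closure_of U" "y = F z" by blast
    then have Z: "z \<in> topspace Z"
      by (simp add: in_closure_of)
    then obtain p where p: "p \<in> \<mu> z" "p \<in> hx U"
      using monad_meets[OF Z U z(1)] by blast
    then show "y \<in> \<phi> ` hx U"
      using Y_map_monad[OF Z p(1)] z(2) by (metis imageI)
  qed
qed

text \<open>The dual of \<open>monad_meets_iff\<close>: \<open>\<mu> z\<close> lies in
  \<open>hx U\<close> exactly when it misses \<open>hx (X - U)\<close>, that is, when
  \<open>z\<close> is outside the closure of \<open>X - U\<close>.\<close>

lemma monad_subset_iff:
  assumes z: "z \<in> topspace Z" and U: "U \<subseteq> X"
  shows "\<mu> z \<subseteq> hx U \<longleftrightarrow> (\<exists>V. openin Z V \<and> z \<in> V \<and> V \<inter> X \<subseteq> U)"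
proof
  assume "\<mu> z \<subseteq> hx U"
  then have "\<mu> z \<inter> hx (X - U) = {}"
    using hx_Diff[of X U] U by auto
  then have "z \<notin> Z closure_of (X - U)"
    using monad_meets_iff[OF z, of "X - U"] by auto
  then obtain V where "openin Z V" "z \<in> V" "V \<inter> (X - U) = {}"
    using z unfolding in_closure_of by blast
  then show "\<exists>V. openin Z V \<and> z \<in> V \<and> V \<inter> X \<subseteq> U"
    by blast
next
  assume "\<exists>V. openin Z V \<and> z \<in> V \<and> V \<inter> X \<subseteq> U"
  then show "\<mu> z \<subseteq> hx U"
    using monad_subset hx_mono[OF _ U] by blast
qed

text \<open>Gives s-points and r-points one common description of the filter base, in terms of
  \<open>Z\<close> alone, so that the comparison of topologies needs no case split.\<close>

lemma Y_base_comp_map: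
  assumes z: "z \<in> topspace Z"
  shows "Y_base hx T r (F z) =
    {F ` (Z closure_of U) |U. openin T U \<and> (\<exists>V. openin Z V \<and> z \<in> V \<and> V \<inter> X \<subseteq> U)}"
proof -
  let ?N = "\<lambda>U. \<exists>V. openin Z V \<and> z \<in> V \<and> V \<inter> X \<subseteq> U"
  have "Y_base hx T r (F z) = {\<phi> ` hx U |U. openin T U \<and> ?N U}"
  proof (cases "z \<in> X")
    case True
    then have "z \<in> U \<longleftrightarrow> ?N U" if "openin T U" for U
      using that unfolding openin_T_iff by blast
    then have "openin T U \<and> z \<in> U \<longleftrightarrow> openin T U \<and> ?N U" for U
      by blast
    then show ?thesis
      using True by (simp add: Y_base_def comp_map_def)
  next
    case False
    have "openin T U \<and> \<mu> z \<subseteq> hx U \<longleftrightarrow> openin T U \<and> ?N U" for U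
      using monad_subset_iff[OF z] openin_subset[of T U] by blast
    then show ?thesis
      using False by (simp add: Y_base_def comp_map_def)
  qed
  moreover have "\<phi> ` hx U = F ` (Z closure_of U)" if "openin T U" for U
    using that by (intro Y_map_image_hx openin_subset)
  then have "(\<exists>U. y = \<phi> ` hx U \<and> openin T U \<and> ?N U) \<longleftrightarrow>
      (\<exists>U. y = F ` (Z closure_of U) \<and> openin T U \<and> ?N U)" for y
    by (intro ex_cong1) auto
  ultimately show ?thesis by simp
qed

lemma Y_open_comp_map_image:
  assumes B: "B \<subseteq> topspace Z"
  shows "Y_open hx T r (F ` B) \<longleftrightarrow> openin Z B"
proof
  assume op: "Y_open hx T r (F ` B)"
  have "\<exists>V. openin Z V \<and> z \<in> V \<and> V \<subseteq> B" if "z \<in> B" for z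
  proof -
    have z: "z \<in> topspace Z"
      using that B by auto
    from op that obtain N where "N \<in> Y_base hx T r (F z)" "N \<subseteq> F ` B"
      by (auto simp: Y_open_def)
    then obtain U V where V: "openin Z V" "z \<in> V" "V \<inter> X \<subseteq> U"
      and FU: "F ` (Z closure_of U) \<subseteq> F ` B"
      unfolding Y_base_comp_map[OF z] by auto
    \<comment> \<open>Density of \<open>X\<close> enters here: an open set lies in the closure of
      its trace.\<close>
    have "V \<subseteq> Z closure_of (V \<inter> X)"
      using openin_Int_closure_of_subset[OF V(1), of X] openin_subset[OF V(1)] dense by auto
    also have "\<dots> \<subseteq> Z closure_of U"
      using V(3) by (rule closure_of_mono)
    \<comment> \<open>Injectivity of \<open>F\<close> turns the inclusion of images into one of
      sets.\<close>
    also have "\<dots> \<subseteq> B"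
      using FU inj_on_image_subset_iff[OF inj_on_comp_map closure_of_subset_topspace B] by simp
    finally show ?thesis using V by blast
  qed
  then show "openin Z B"
    by (subst openin_subopen) blast
next
  assume op: "openin Z B"
  have "\<exists>N\<in>Y_base hx T r (F z). N \<subseteq> F ` B" if zB: "z \<in> B" for z
  proof -
    \<comment> \<open>Base members come from closures, so a closed neighbourhood \<open>C\<close> of
      \<open>z\<close> inside \<open>B\<close> is needed; the closure of the trace of
      \<open>V\<close> stays within \<open>C\<close>.\<close>
    have "regular_space Z"
      using compact_Z Hausdorff_Z compact_Hausdorff_imp_regular_space by blast
    then obtain V C where V: "openin Z V" "closedin Z C" "z \<in> V" "V \<subseteq> C" "C \<subseteq> B"
      using op zB
      unfolding neighbourhood_base_of_closedin[symmetric] neighbourhood_base_of by meson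
    then have "Z closure_of (V \<inter> X) \<subseteq> B"
      by (meson closure_of_minimal inf.coboundedI1 subset_trans)
    moreover have "F ` (Z closure_of (V \<inter> X)) \<in> Y_base hx T r (F z)"
      using V zB B openin_trace[OF V(1)] by (subst Y_base_comp_map) auto
    ultimately show ?thesis by blast
  qed
  then show "Y_open hx T r (F ` B)"
    using image_mono[OF B, of F] comp_map_image by (auto simp: Y_open_def)
qed

lemma bij_betw_comp_map: "bij_betw F (topspace Z) (Y_points hx T r)"
  using comp_map_image inj_on_comp_map by (simp add: bij_betw_def)

lemma homeomorphic_map_comp_map: "homeomorphic_map Z (Y_space hx T r) F"
proof -
  have open_iff: "openin (Y_space hx T r) = Y_open hx T r"
    unfolding Y_space_def using istopology_Y_open[OF hx_Int] by (rule topology_inverse')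
  have "Y_open hx T r (Y_points hx T r)"
    using Y_open_comp_map_image[of "topspace Z"] comp_map_image by simp
  then have top: "topspace (Y_space hx T r) = Y_points hx T r"
    unfolding topspace_def open_iff by (auto simp: Y_open_def)
  show ?thesis
    unfolding homeomorphic_map_def quotient_map_def top open_iff
  \<comment> \<open>A homeomorphism is here an injective quotient map, so the comparison of open
    sets with their preimages remains.\<close>
  proof (intro conjI allI impI comp_map_image inj_on_comp_map)
    fix U assume "U \<subseteq> Y_points hx T r"
    then have "U \<subseteq> F ` topspace Z"
      by (simp add: comp_map_image)
    then have "F ` {z \<in> topspace Z. F z \<in> U} = U"
      by blast
    then show "openin Z {z \<in> topspace Z. F z \<in> U} \<longleftrightarrow> Y_open hx T r U"
      using Y_open_comp_map_image[of "{z \<in> topspace Z. F z \<in> U}"] by simp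
  qed
qed

end

theorem theorem3p2:
  fixes T :: "'a topology"
    and V :: "('a, 's) superstr" and W :: "('b, 't) superstr"
    and star :: "'a + 's \<Rightarrow> 'b + 't"
    and h :: enat and \<kappa> :: "'k rel"
  assumes "regular_space T" and "Hausdorff_space T" and "\<not> compact_space T"
    and "nonstandard_extension h V W star" and "topspace T \<subseteq> individuals V"
    and "Card_order \<kappa>" and "|{U. openin T U}| <o \<kappa>" and "saturated \<kappa> V W star"
  defines "hx \<equiv> hyperset V W star"
  shows "(\<forall>Z. Hausdorff_compactification T Z \<longrightarrow>
            equiv (remote_points hx T) (comp_rel hx T Z) \<and>
            bij_betw (comp_map hx T Z) (topspace Z) (Y_points hx T (comp_rel hx T Z)) \<and>
            homeomorphic_map Z (Y_space hx T (comp_rel hx T Z)) (comp_map hx T Z)) \<and>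
         (\<forall>Z. Hausdorff_compactification T Z \<longrightarrow>
            (\<exists>r F. equiv (remote_points hx T) r \<and>
                   homeomorphic_map Z (Y_space hx T r) F \<and>
                   (\<forall>x\<in>topspace T. F x = Inl x)))"
proof -
  have X: "A \<subseteq> individuals V" if "A \<subseteq> topspace T" for A
    using that assms(5) by blast
  have loc: "saturated_compactification hx T Z" if "Hausdorff_compactification T Z" for Z
  proof
    show "Hausdorff_compactification T Z" by fact
    show "hx (A \<inter> B) = hx A \<inter> hx B" if "A \<subseteq> topspace T" "B \<subseteq> topspace T" for A B
      using that X unfolding hx_def by (intro hyperset_Int[OF assms(4)])
    show "hx (A - B) = hx A - hx B" if "A \<subseteq> topspace T" "B \<subseteq> topspace T" for A B
      using that X unfolding hx_def by (intro hyperset_Diff[OF assms(4)])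
    fix \<A> :: "'a set set"
    assume \<A>: "\<A> \<subseteq> Pow (topspace T)" "|\<A>| \<le>o |{U. openin T U}|" "\<A> \<noteq> {}"
      and fip: "\<And>\<G>. finite \<G> \<Longrightarrow> \<G> \<subseteq> \<A> \<Longrightarrow> \<Inter>\<G> \<noteq> {}"
    show "\<Inter>(hx ` \<A>) \<noteq> {}"
      unfolding hx_def
    proof (rule hyperset_saturated[OF assms(4,8) _ _ \<A>(3) fip])
      show "\<A> \<subseteq> Pow (individuals V)"
        using \<A>(1) X by auto
      show "|\<A>| <o \<kappa>"
        using \<A>(2) assms(7) by (rule ordLeq_ordLess_trans)
    qed auto
  qed
  \<comment> \<open>The relation and the map of the first claim are the witnesses for the
    second.\<close>
  show ?thesis
    using saturated_compactification.equiv_comp_rel[OF loc]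
      saturated_compactification.bij_betw_comp_map[OF loc]
      saturated_compactification.homeomorphic_map_comp_map[OF loc]
    by (auto intro!: exI[of _ "comp_rel hx T _"] exI[of _ "comp_map hx T _"] simp: comp_map_def)
qed

end
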